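(* For every integer $k\ge 2$, $b_{k,2}=\frac{k}{2}$.
   Context: Let $H_{n,k}=\{0,1,\dots,n-1\}^k$. A $2$-rook is a point $P\in H_{n,k}$ together with a set $D$ of $2$ of the $k$ coordinate indices; it attacks every point of $H_{n,k}$ which differs from $P$ in exactly one coordinate, that coordinate belonging to $D$. Distinct rooks must occupy distinct points. $b_{n,k,2}$ is the maximum number of $2$-rooks that can be placed in $H_{n,k}$ so that no rook attacks the position of another rook, and $b_{k,2}=\lim_{n\to\infty} b_{n,k,2}/n^{k-1}$ (this limit exists). *)

theory Defs
  imports Complex_Main "HOL-Library.FuncSet"
begin

text \<open>Coordinates are indexed by \<open>0, \<dots>, k - 1\<close>; points are extensional functions, so that two points
  are equal iff they agree in all \<open>k\<close> coordinates.\<close>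

definition board :: "nat \<Rightarrow> nat \<Rightarrow> (nat \<Rightarrow> nat) set" where
  "board n k = {..<k} \<rightarrow>\<^sub>E {..<n}"

text \<open>A rook is a pair of its position and its set of attack directions.\<close>

type_synonym rook = "(nat \<Rightarrow> nat) \<times> nat set"

definition rooks :: "nat \<Rightarrow> nat \<Rightarrow> nat \<Rightarrow> rook set" where
  "rooks n k l = {(P, D). P \<in> board n k \<and> D \<subseteq> {..<k} \<and> card D = l}"

definition attacks :: "nat \<Rightarrow> rook \<Rightarrow> (nat \<Rightarrow> nat) \<Rightarrow> bool" where
  "attacks k r Q \<longleftrightarrow> (\<exists>i\<in>snd r. {j. j < k \<and> Q j \<noteq> fst r j} = {i})"

text \<open>Injectivity of \<^const>\<open>fst\<close> says that distinct rooks occupy distinct points, even if their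
  direction sets differ.\<close>

definition nonattacking :: "nat \<Rightarrow> nat \<Rightarrow> nat \<Rightarrow> rook set \<Rightarrow> bool" where
  "nonattacking n k l S \<longleftrightarrow>
     S \<subseteq> rooks n k l \<and> inj_on fst S \<and>
     (\<forall>r\<in>S. \<forall>s\<in>S. r \<noteq> s \<longrightarrow> \<not> attacks k r (fst s))"

definition max_rooks :: "nat \<Rightarrow> nat \<Rightarrow> nat \<Rightarrow> nat" where
  "max_rooks n k l = Max (card ` {S. nonattacking n k l S})"

lemma finite_rooks: "finite (rooks n k l)"
proof (rule finite_subset)
  show "rooks n k l \<subseteq> board n k \<times> Pow {..<k}"
    by (auto simp: rooks_def)
  show "finite (board n k \<times> Pow {..<k})"
    by (auto simp: board_def intro: finite_PiE)
qed

text \<open>The set whose maximum is taken in \<^const>\<open>max_rooks\<close> is finite and nonempty.\<close>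

lemma finite_nonattacking: "finite {S. nonattacking n k l S}"
  by (rule finite_subset[of _ "Pow (rooks n k l)"])
    (auto simp: nonattacking_def finite_rooks)

lemma nonattacking_empty: "nonattacking n k l {}"
  by (simp add: nonattacking_def)

end

theory Submission imports Defs begin

text \<open>Say that a rook owns the lines through its position in its attack directions. No line is owned
  twice, and there are \<open>k n\<^bsup>k-1\<^esup>\<close> lines, which gives the upper bound \<open>k n\<^bsup>k-1\<^esup> / 2\<close>.

  For the lower bound almost all lines have to be owned. Label the coordinates other than \<open>i\<close>
  bijectively by the residues modulo \<open>k - 1\<close>, the label of \<open>j\<close> being \<open>slot i j\<close>. A line in direction
  \<open>i\<close> is to be owned by a rook with directions \<open>{i, j}\<close>, where \<open>slot i j\<close> is the residue of the sum
  of the fixed coordinates of the line. The demands of the directions \<open>i\<close> and \<open>j\<close> are compatible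
  if \<open>P i + slot i j = P j + slot j i\<close>, and then this equation determines the rook on the line. If
  only points are used where this equation holds for exactly one pair, then no rook attacks another
  one, and only \<open>O(n\<^bsup>k-2\<^esup>)\<close> lines remain without owner.\<close>

section \<open>Labels, links and the rook placement\<close>

definition slot :: "nat \<Rightarrow> nat \<Rightarrow> nat" where
  "slot i j = (if j < i then j else j - 1)"

definition linked :: "(nat \<Rightarrow> nat) \<Rightarrow> nat \<Rightarrow> nat \<Rightarrow> bool" where
  "linked P i j \<longleftrightarrow> i \<noteq> j \<and> P i + slot i j = P j + slot j i"

text \<open>Adding \<open>P i\<close> to both sides of the demand on a line in direction
  \<open>i\<close> turns the sum of the fixed coordinates into the sum of all coordinates. Together
  with \<open>linked P i j\<close> this makes the condition symmetric in \<open>i\<close> and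
  \<open>j\<close>, so it depends only on the unordered pair.\<close>

definition linked_rooks :: "nat \<Rightarrow> nat \<Rightarrow> rook set" where
  "linked_rooks n k = {(P, {i, j}) | P i j. P \<in> board n k \<and> i < k \<and> j < k \<and> linked P i j \<and>
     sum P {..<k} mod (k - 1) = (P i + slot i j) mod (k - 1) \<and>
     (\<forall>a<k. \<forall>b<k. linked P a b \<longrightarrow> {a, b} = {i, j})}"

definition owners :: "rook set \<Rightarrow> nat \<Rightarrow> rook set" where
  "owners S i = {s \<in> S. i \<in> snd s}"

text \<open>A line in direction \<open>i\<close> is represented by its fixed coordinates.\<close>

definition line :: "nat \<Rightarrow> nat \<Rightarrow> rook \<Rightarrow> nat \<Rightarrow> nat" where
  "line k i s = restrict (fst s) ({..<k} - {i})"

text \<open>The margins of width \<open>k\<close> keep the solution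
  \<open>y j + slot j i - slot i j\<close> of a link equation inside the board. The offsets reach
  \<open>2 * k\<close> because eliminating coordinate \<open>i\<close> from two links leaves a sum
  of two slots on each side.\<close>

definition bad_lines :: "nat \<Rightarrow> nat \<Rightarrow> nat \<Rightarrow> (nat \<Rightarrow> nat) set" where
  "bad_lines n k i = {y \<in> ({..<k} - {i}) \<rightarrow>\<^sub>E {..<n}.
     (\<exists>a\<in>{..<k} - {i}. y a < k \<or> n \<le> y a + k) \<or>
     (\<exists>a\<in>{..<k} - {i}. \<exists>b\<in>{..<k} - {i}. a \<noteq> b \<and> (\<exists>c\<le>2 * k. \<exists>d\<le>2 * k. y a + c = y b + d))}"

lemma board_restrict:
  "P \<in> board n k \<Longrightarrow> restrict P ({..<k} - {i}) \<in> ({..<k} - {i}) \<rightarrow>\<^sub>E {..<n}"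
  by (auto simp: board_def PiE_iff)

lemma card_lines:
  assumes "i < k"
  shows "card (({..<k} - {i}) \<rightarrow>\<^sub>E {..<n}) = n ^ (k - 1)"
  using assms by (simp add: card_PiE)

lemma slot_less: "\<lbrakk>i \<noteq> j; i < k; j < k\<rbrakk> \<Longrightarrow> slot i j < k - 1"
  by (auto simp: slot_def)

lemma slot_inj: "\<lbrakk>slot i j = slot i m; j \<noteq> i; m \<noteq> i\<rbrakk> \<Longrightarrow> j = m"
  by (auto simp: slot_def split: if_splits)

lemma slot_surj:
  assumes "t < k - 1" "i < k"
  obtains j where "j < k" "j \<noteq> i" "slot i j = t"
proof (cases "t < i")
  case True
  with assms show ?thesis by (intro that[of t]) (auto simp: slot_def)
next
  case False
  with assms show ?thesis by (intro that[of "Suc t"]) (auto simp: slot_def)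
qed

section \<open>Upper bound by counting owned lines\<close>

lemma nonattacking_finite: "nonattacking n k l S \<Longrightarrow> finite S"
  by (auto simp: nonattacking_def intro: finite_subset[OF _ finite_rooks])

text \<open>Double counting of pairs of a rook and one of its directions.\<close>

lemma sum_card_owners:
  assumes "nonattacking n k l S"
  shows "(\<Sum>i<k. card (owners S i)) = l * card S"
proof -
  have S: "S \<subseteq> rooks n k l" using assms by (simp add: nonattacking_def)
  show ?thesis
    unfolding owners_def
  proof (rule sum_multicount)
    show "\<forall>s\<in>S. card {i \<in> {..<k}. i \<in> snd s} = l"
    proof
      fix s assume "s \<in> S"
      hence "s \<in> rooks n k l" using S by blast
      hence "snd s \<subseteq> {..<k}" "card (snd s) = l" by (auto simp: rooks_def)
      moreover from this(1) have "{i \<in> {..<k}. i \<in> snd s} = snd s" by auto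
      ultimately show "card {i \<in> {..<k}. i \<in> snd s} = l" by simp
    qed
  qed (use nonattacking_finite[OF assms] in auto)
qed

lemma restrict_eq_imp_differ:
  assumes "P \<in> board n k" "Q \<in> board n k" "P \<noteq> Q"
    and "restrict P ({..<k} - {i}) = restrict Q ({..<k} - {i})"
  shows "{j. j < k \<and> Q j \<noteq> P j} = {i}"
proof -
  have eq: "P j = Q j" if "j < k" "j \<noteq> i" for j
    using fun_cong[OF assms(4), of j] that by simp
  obtain j where "P j \<noteq> Q j" using assms(3) by auto
  \<comment> \<open>Both points are \<open>undefined\<close> outside \<open>{..<k}\<close>, so they
    cannot differ there.\<close>
  moreover from this have "j < k"
    using assms(1,2) by (metis PiE_arb board_def lessThan_iff)
  ultimately show ?thesis using eq by auto metis+
qed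

text \<open>Two owners of one line differ exactly in coordinate \<open>i\<close>, which is an attack
  direction of both.\<close>

lemma inj_on_line_owners:
  assumes "nonattacking n k l S"
  shows "inj_on (line k i) (owners S i)"
proof (rule inj_onI, rule ccontr)
  fix s t
  assume st: "s \<in> owners S i" "t \<in> owners S i" "line k i s = line k i t" "s \<noteq> t"
  have "fst s \<in> board n k" "fst t \<in> board n k" "fst s \<noteq> fst t" "\<not> attacks k s (fst t)"
    using assms st by (auto simp: nonattacking_def owners_def rooks_def inj_on_def)
  with st show False
    using restrict_eq_imp_differ[of "fst s" n k "fst t" i]
    by (auto simp: attacks_def owners_def line_def)
qed

lemma card_nonattacking_le:
  assumes "nonattacking n k l S"
  shows "l * card S \<le> k * n ^ (k - 1)"
proof -
  have "card (owners S i) \<le> n ^ (k - 1)" if "i < k" for i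
  proof -
    have "fst s \<in> board n k" if "s \<in> owners S i" for s
      using assms that by (auto simp: owners_def nonattacking_def rooks_def)
    hence "line k i ` owners S i \<subseteq> ({..<k} - {i}) \<rightarrow>\<^sub>E {..<n}"
      using board_restrict unfolding line_def by blast
    hence "card (owners S i) \<le> card (({..<k} - {i}) \<rightarrow>\<^sub>E {..<n})"
      using inj_on_line_owners[OF assms] by (intro card_inj_on_le) (auto intro: finite_PiE)
    thus ?thesis using that by (simp only: card_lines)
  qed
  hence "(\<Sum>i<k. card (owners S i)) \<le> (\<Sum>i<k. n ^ (k - 1))" by (intro sum_mono) auto
  thus ?thesis using sum_card_owners[OF assms] by simp
qed

section \<open>The placement is nonattacking\<close>

lemma linked_cong: "\<lbrakk>P a = Q a; P b = Q b\<rbrakk> \<Longrightarrow> linked P a b = linked Q a b"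
  by (simp add: linked_def)

lemma linked_sym: "linked P a b = linked P b a"
  by (auto simp: linked_def)

text \<open>By symmetry, any given direction of a rook can take the role of the first one.\<close>

lemma linked_rooksE:
  assumes "s \<in> linked_rooks n k" "i \<in> snd s"
  obtains j where "i < k" "j < k" "snd s = {i, j}" "linked (fst s) i j" "fst s \<in> board n k"
    "sum (fst s) {..<k} mod (k - 1) = (fst s i + slot i j) mod (k - 1)"
    "\<forall>a<k. \<forall>b<k. linked (fst s) a b \<longrightarrow> {a, b} = {i, j}"
proof -
  obtain P a b where s: "s = (P, {a, b})" "P \<in> board n k" "a < k" "b < k" "linked P a b"
      "sum P {..<k} mod (k - 1) = (P a + slot a b) mod (k - 1)"
      and uniq: "\<forall>c<k. \<forall>d<k. linked P c d \<longrightarrow> {c, d} = {a, b}"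
    using assms(1) unfolding linked_rooks_def by blast
  have P: "fst s = P" "snd s = {a, b}" using s(1) by simp_all
  from assms(2) P(2) consider "i = a" | "i = b" by auto
  thus ?thesis
  proof cases
    case 1
    show ?thesis
      using that[of b] s uniq unfolding 1 P by blast
  next
    case 2
    have "P a + slot a b = P b + slot b a" "linked P b a" "{a, b} = {b, a}"
      using s(5) by (auto simp: linked_def)
    thus ?thesis
      using that[of a] s uniq unfolding 2 P by metis
  qed
qed

lemma sum_remove_coord: "i < k \<Longrightarrow> sum P {..<k} = P i + sum P ({..<k} - {i})" for P :: "nat \<Rightarrow> nat"
  by (simp add: sum.remove)

text \<open>Cancelling \<open>P i\<close> recovers the demand of the line, which involves only
  coordinates constant along it.\<close>

lemma linked_rooks_line_sum:
  assumes "i < k" "j < k" "linked P i j"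
    and "sum P {..<k} mod (k - 1) = (P i + slot i j) mod (k - 1)"
  shows "sum P ({..<k} - {i}) mod (k - 1) = slot i j"
proof -
  have "slot i j < k - 1" using assms slot_less by (auto simp: linked_def)
  moreover have "sum P ({..<k} - {i}) mod (k - 1) = slot i j mod (k - 1)"
    using assms(4) unfolding sum_remove_coord[OF assms(1)]
    by (simp add: nat_mod_eq_iff)
  ultimately show ?thesis by simp
qed

lemma nonattacking_linked_rooks: "nonattacking n k 2 (linked_rooks n k)"
proof -
  have attack_dir: "\<exists>i. i \<in> snd s" if s: "s \<in> linked_rooks n k" for s
  proof -
    obtain P i j where "s = (P, {i, j})" using s unfolding linked_rooks_def by blast
    thus ?thesis by auto
  qed
  have "s \<in> rooks n k 2" if s: "s \<in> linked_rooks n k" for s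
  proof -
    obtain i where i: "i \<in> snd s" using attack_dir[OF s] ..
    obtain j where "i < k" "j < k" "snd s = {i, j}" "linked (fst s) i j" "fst s \<in> board n k"
      by (rule linked_rooksE[OF s i])
    thus ?thesis by (cases s) (simp add: rooks_def linked_def)
  qed
  hence "linked_rooks n k \<subseteq> rooks n k 2" ..
  \<comment> \<open>The position determines the directions, since they form its only linked
    pair.\<close>
  moreover have "inj_on fst (linked_rooks n k)"
  proof (rule inj_onI)
    fix r s assume rs: "r \<in> linked_rooks n k" "s \<in> linked_rooks n k" "fst r = fst s"
    obtain a where a: "a \<in> snd r" using attack_dir[OF rs(1)] ..
    obtain b where ab: "a < k" "b < k" "snd r = {a, b}" "linked (fst r) a b"
      by (rule linked_rooksE[OF rs(1) a])
    obtain i where i: "i \<in> snd s" using attack_dir[OF rs(2)] ..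
    obtain j where "snd s = {i, j}"
        and uniq: "\<forall>a<k. \<forall>b<k. linked (fst s) a b \<longrightarrow> {a, b} = {i, j}"
      by (rule linked_rooksE[OF rs(2) i])
    with ab rs(3) uniq[rule_format, of a b] have "snd r = snd s" by simp
    with rs(3) show "r = s" by (simp add: prod_eq_iff)
  qed
  moreover have "\<not> attacks k r (fst s)"
    if r: "r \<in> linked_rooks n k" and s: "s \<in> linked_rooks n k" for r s
  proof
    assume "attacks k r (fst s)"
    then obtain i where i: "i \<in> snd r" and diff: "{j. j < k \<and> fst s j \<noteq> fst r j} = {i}"
      by (auto simp: attacks_def)
    have agree: "fst s l = fst r l" if "l < k" "l \<noteq> i" for l using diff that by blast
    obtain j where j: "i < k" "j < k" "snd r = {i, j}" "linked (fst r) i j"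
        "sum (fst r) {..<k} mod (k - 1) = (fst r i + slot i j) mod (k - 1)"
        "\<forall>a<k. \<forall>b<k. linked (fst r) a b \<longrightarrow> {a, b} = {i, j}"
      by (rule linked_rooksE[OF r i])
    \<comment> \<open>Otherwise the linked pair of \<open>s\<close> avoids \<open>i\<close>, so it
      is also linked in \<open>r\<close> and must equal \<open>{i, j}\<close>, which contains
      \<open>i\<close>.\<close>
    have "i \<in> snd s"
    proof (rule ccontr)
      assume ni: "i \<notin> snd s"
      obtain a where a: "a \<in> snd s" using attack_dir[OF s] ..
      obtain b where ab: "a < k" "b < k" "snd s = {a, b}" "linked (fst s) a b"
        by (rule linked_rooksE[OF s a])
      with ni have "a \<noteq> i" "b \<noteq> i" by auto
      with ab have "linked (fst r) a b" using linked_cong[of "fst s" a "fst r" b] agree by blast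
      with j(6)[rule_format, of a b] ab have "{a, b} = {i, j}" by simp
      with ni ab show False by auto
    qed
    then obtain m where m: "m < k" "linked (fst s) i m"
        "sum (fst s) {..<k} mod (k - 1) = (fst s i + slot i m) mod (k - 1)"
      by (rule linked_rooksE[OF s])
    \<comment> \<open>Both rooks lie on one line in direction \<open>i\<close>, whose residue is the
      slot of either partner.\<close>
    have "slot i j = sum (fst r) ({..<k} - {i}) mod (k - 1)"
      by (rule linked_rooks_line_sum[OF j(1,2,4,5), symmetric])
    also have "\<dots> = sum (fst s) ({..<k} - {i}) mod (k - 1)"
      using agree by (intro arg_cong[of _ _ "\<lambda>x. x mod (k - 1)"] sum.cong) auto
    also have "\<dots> = slot i m"
      by (rule linked_rooks_line_sum[OF j(1) m])
    finally have "j = m" using slot_inj[of i j m] j(4) m(2) by (auto simp: linked_def)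
    \<comment> \<open>With a common partner \<open>j\<close>, the link equation computes coordinate
      \<open>i\<close> from coordinate \<open>j\<close>, where the positions agree.\<close>
    hence "fst s i = fst r i" using j(2,4) m(2) agree[of j] by (auto simp: linked_def)
    thus False using diff by auto
  qed
  ultimately show ?thesis by (auto simp: nonattacking_def)
qed

section \<open>Few lines are bad\<close>

text \<open>Forgetting coordinate \<open>a\<close> is injective on \<open>X\<close>.\<close>

lemma card_determined_coord_le:
  assumes "finite I" "a \<in> I" "X \<subseteq> I \<rightarrow>\<^sub>E {..<n}"
    and det: "\<And>y z. \<lbrakk>y \<in> X; z \<in> X; \<And>b. b \<in> I - {a} \<Longrightarrow> y b = z b\<rbrakk> \<Longrightarrow> y a = z a"
  shows "card X \<le> n ^ (card I - 1)"
proof -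
  have "inj_on (\<lambda>y. restrict y (I - {a})) X"
  proof (rule inj_onI)
    fix y z assume yz: "y \<in> X" "z \<in> X" and eq: "restrict y (I - {a}) = restrict z (I - {a})"
    have agree: "y b = z b" if "b \<in> I - {a}" for b using fun_cong[OF eq, of b] that by simp
    with det[OF yz] have "y b = z b" if "b \<in> I" for b using that by (cases "b = a") auto
    with yz assms(3) show "y = z" by (intro PiE_ext[of y I _ z]) auto
  qed
  moreover have "(\<lambda>y. restrict y (I - {a})) ` X \<subseteq> (I - {a}) \<rightarrow>\<^sub>E {..<n}"
    using assms(3) by (force simp: PiE_iff)
  ultimately have "card X \<le> card ((I - {a}) \<rightarrow>\<^sub>E {..<n})"
    using assms(1) by (intro card_inj_on_le) (auto intro: finite_PiE)
  thus ?thesis using assms(1,2) by (simp add: card_PiE)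
qed

text \<open>Each way of being bad is one equation that determines a coordinate from the others, and
  the number of these equations depends only on \<open>k\<close>.\<close>

lemma card_bad_lines_le:
  assumes "i < k"
  shows "card (bad_lines n k i) \<le> (k * (k * ((2 * k + 1) * (2 * k + 1))) + 2 * (k * (k + 1))) * n ^ (k - 2)"
proof -
  define I where "I = {..<k} - {i}"
  define E where "E = I \<rightarrow>\<^sub>E {..<n}"
  define T where "T = I \<times> I \<times> {..2 * k} \<times> {..2 * k}"
  \<comment> \<open>\<open>X\<close> collects near coincidences of two coordinates, \<open>Y\<close>
    small values and \<open>Z\<close> values close to \<open>n\<close>.\<close>
  define X where "X = (\<lambda>(a, b, c, d). {y \<in> E. a \<noteq> b \<and> y a + c = y b + d})"
  define Y where "Y = (\<lambda>(a, c). {y \<in> E. y a = c})"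
  define Z where "Z = (\<lambda>(a, c). {y \<in> E. y a + c = n})"
  have I: "finite I" "card I = k - 1" using assms by (auto simp: I_def)
  hence finE: "finite E" by (auto simp: E_def intro: finite_PiE)
  have det: "card V \<le> n ^ (k - 2)"
    if "a \<in> I" "V \<subseteq> E"
      "\<And>y z. \<lbrakk>y \<in> V; z \<in> V; \<And>b. b \<in> I - {a} \<Longrightarrow> y b = z b\<rbrakk> \<Longrightarrow> y a = z a" for a V
  proof -
    have "card V \<le> n ^ (card I - 1)"
      by (rule card_determined_coord_le[OF I(1) that(1) that(2)[unfolded E_def]]) (rule that(3))
    thus ?thesis using I(2) by (simp add: numeral_2_eq_2)
  qed
  have "card (X t) \<le> n ^ (k - 2)" if "t \<in> T" for t
  proof -
    obtain a b c d where t: "t = (a, b, c, d)" by (metis prod_cases4)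
    hence "a \<in> I" "b \<in> I" using that by (auto simp: T_def)
    show ?thesis
    proof (rule det[OF \<open>a \<in> I\<close>])
      fix y z assume "y \<in> X t" "z \<in> X t" and agree: "\<And>b. b \<in> I - {a} \<Longrightarrow> y b = z b"
      hence "a \<noteq> b" "y a + c = y b + d" "z a + c = z b + d" by (auto simp: X_def t)
      thus "y a = z a" using agree[of b] \<open>b \<in> I\<close> by auto
    qed (auto simp: X_def t)
  qed
  hence X: "card (\<Union> (X ` T)) \<le> card T * n ^ (k - 2)"
    using I(1) by (intro order_trans[OF card_UN_le] order_trans[OF sum_bounded_above])
      (auto simp: T_def)
  have "card (Y t) \<le> n ^ (k - 2)" if "t \<in> I \<times> {..k}" for t
    using that by (cases t) (auto simp: Y_def intro!: det[of "fst t"])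
  hence Y: "card (\<Union> (Y ` (I \<times> {..k}))) \<le> card (I \<times> {..k}) * n ^ (k - 2)"
    using I(1) by (intro order_trans[OF card_UN_le] order_trans[OF sum_bounded_above]) auto
  have "card (Z t) \<le> n ^ (k - 2)" if "t \<in> I \<times> {..k}" for t
    using that by (cases t) (auto simp: Z_def intro!: det[of "fst t"])
  hence Z: "card (\<Union> (Z ` (I \<times> {..k}))) \<le> card (I \<times> {..k}) * n ^ (k - 2)"
    using I(1) by (intro order_trans[OF card_UN_le] order_trans[OF sum_bounded_above]) auto
  have sub: "bad_lines n k i \<subseteq> \<Union> (X ` T) \<union> (\<Union> (Y ` (I \<times> {..k})) \<union> \<Union> (Z ` (I \<times> {..k})))"
  proof
    fix y assume y: "y \<in> bad_lines n k i"
    hence yE: "y \<in> E" by (auto simp: bad_lines_def E_def I_def)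
    from y consider (low) a where "a \<in> I" "y a < k" | (high) a where "a \<in> I" "n \<le> y a + k"
      | (eq) a b c d where "a \<in> I" "b \<in> I" "a \<noteq> b" "c \<le> 2 * k" "d \<le> 2 * k" "y a + c = y b + d"
      unfolding bad_lines_def I_def[symmetric] by blast
    thus "y \<in> \<Union> (X ` T) \<union> (\<Union> (Y ` (I \<times> {..k})) \<union> \<Union> (Z ` (I \<times> {..k})))"
    proof cases
      case low
      hence "y \<in> Y (a, y a)" "(a, y a) \<in> I \<times> {..k}" using yE by (auto simp: Y_def)
      thus ?thesis by blast
    next
      case high
      have "y a < n" using yE high(1) by (auto simp: E_def)
      hence "y \<in> Z (a, n - y a)" "(a, n - y a) \<in> I \<times> {..k}" using yE high by (auto simp: Z_def)
      thus ?thesis by blast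
    next
      case eq
      hence "y \<in> X (a, b, c, d)" "(a, b, c, d) \<in> T" using yE by (auto simp: X_def T_def)
      thus ?thesis by blast
    qed
  qed
  have "card (bad_lines n k i) \<le> card (\<Union> (X ` T) \<union> (\<Union> (Y ` (I \<times> {..k})) \<union> \<Union> (Z ` (I \<times> {..k}))))"
    by (intro card_mono[OF _ sub] finite_subset[OF _ finE]) (auto simp: X_def Y_def Z_def)
  also have "\<dots> \<le> card (\<Union> (X ` T)) + (card (\<Union> (Y ` (I \<times> {..k}))) + card (\<Union> (Z ` (I \<times> {..k}))))"
    by (intro order_trans[OF card_Un_le] add_left_mono card_Un_le)
  also have "\<dots> \<le> card T * n ^ (k - 2) +
      (card (I \<times> {..k}) * n ^ (k - 2) + card (I \<times> {..k}) * n ^ (k - 2))"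
    by (intro add_mono X Y Z)
  also have "\<dots> = (card T + 2 * card (I \<times> {..k})) * n ^ (k - 2)"
    by (simp add: algebra_simps)
  \<comment> \<open>The size \<open>k - 1\<close> of \<open>I\<close> is rounded up to
    \<open>k\<close>.\<close>
  also have "\<dots> \<le> (k * (k * ((2 * k + 1) * (2 * k + 1))) + 2 * (k * (k + 1))) * n ^ (k - 2)"
    unfolding T_def card_cartesian_product card_atMost I(2) Suc_eq_plus1
    by (intro mult_right_mono add_mono mult_mono) auto
  finally show ?thesis .
qed

section \<open>Lower bound from the good lines\<close>

text \<open>The residue of the line selects the partner \<open>j\<close>, and the link equation then
  selects the point. That the line is good puts this point on the board and rules out further
  links.\<close>

lemma good_line_owned:
  assumes "i < k" "k \<ge> 2" and y: "y \<in> ({..<k} - {i}) \<rightarrow>\<^sub>E {..<n}" "y \<notin> bad_lines n k i"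
  shows "y \<in> line k i ` owners (linked_rooks n k) i"
proof -
  define t where "t = sum y ({..<k} - {i}) mod (k - 1)"
  have "t < k - 1" using assms by (simp add: t_def)
  with assms(1) obtain j where j: "j < k" "j \<noteq> i" "slot i j = t" using slot_surj by blast
  have slot_le: "slot a b \<le> k" if "a < k" "b < k" for a b
    using that by (auto simp: slot_def)
  have bound: "k \<le> y a" "y a + k < n" if "a < k" "a \<noteq> i" for a
    using y that by (auto simp: bad_lines_def not_le not_less)
  have distinct: "y a + c \<noteq> y b + d"
    if "a < k" "a \<noteq> i" "b < k" "b \<noteq> i" "a \<noteq> b" "c \<le> 2 * k" "d \<le> 2 * k" for a b c d
    using y that unfolding bad_lines_def by blast
  \<comment> \<open>Coordinate \<open>i\<close> solves the link equation with \<open>j\<close>. The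
    subtraction does not truncate, because \<open>slot i j \<le> k \<le> y j\<close>.\<close>
  define P where "P = y(i := y j + slot j i - slot i j)"
  have Pi: "P i + slot i j = y j + slot j i"
    using bound(1)[of j] j slot_le[of i j] assms(1) by (simp add: P_def)
  have P: "P a = y a" if "a \<noteq> i" for a using that by (simp add: P_def)
  have linked: "linked P i j" using Pi j by (simp add: linked_def P)
  have board: "P \<in> board n k"
    unfolding board_def
  proof (rule PiE_I)
    fix a assume "a \<in> {..<k}"
    thus "P a \<in> {..<n}"
      using y(1) Pi bound(2)[of j] slot_le[of j i] j assms(1) by (cases "a = i") (auto simp: P)
  next
    fix a assume "a \<notin> {..<k}"
    thus "P a = undefined" using y(1) assms(1) P by (auto simp: PiE_iff extensional_def)
  qed
  have "sum P ({..<k} - {i}) = sum y ({..<k} - {i})" by (intro sum.cong) (auto simp: P)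
  hence sum: "sum P {..<k} mod (k - 1) = (P i + slot i j) mod (k - 1)"
    unfolding sum_remove_coord[OF assms(1)] j(3) t_def by (simp add: mod_add_right_eq)
  \<comment> \<open>Eliminating \<open>P i\<close> from the links with \<open>j\<close> and
    \<open>b\<close> would give a forbidden near coincidence of \<open>y j\<close> and
    \<open>y b\<close>.\<close>
  have unlinked: "\<not> linked P i b" if "b < k" "b \<noteq> j" for b
  proof
    assume l: "linked P i b"
    hence "b \<noteq> i" by (auto simp: linked_def)
    with l have "P i + slot i b = y b + slot b i" by (simp add: linked_def P)
    with Pi have "y j + (slot j i + slot i b) = y b + (slot b i + slot i j)" by simp
    thus False
      using distinct[of j b "slot j i + slot i b" "slot b i + slot i j"] j that assms(1) \<open>b \<noteq> i\<close>
        slot_le[of j i] slot_le[of i b] slot_le[of b i] slot_le[of i j] by auto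
  qed
  have "{a, b} = {i, j}" if ab: "a < k" "b < k" "linked P a b" for a b
  proof -
    consider "a = i" | "b = i" | "a \<noteq> i" "b \<noteq> i" by blast
    thus ?thesis
    proof cases
      case 3
      hence "y a + slot a b = y b + slot b a" "a \<noteq> b" using ab by (auto simp: linked_def P)
      thus ?thesis
        using distinct[of a b "slot a b" "slot b a"] 3 ab slot_le[of a b] slot_le[of b a] by auto
    qed (use ab unlinked linked_sym[of P a b] in auto)
  qed
  hence "(P, {i, j}) \<in> linked_rooks n k"
    unfolding linked_rooks_def using board assms(1) j(1) linked sum by blast
  hence "(P, {i, j}) \<in> owners (linked_rooks n k) i" by (simp add: owners_def)
  moreover have "line k i (P, {i, j}) = y"
    using y(1) by (auto simp: line_def P PiE_iff extensional_def restrict_def)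
  ultimately show ?thesis by (metis image_eqI)
qed

text \<open>In each direction only bad lines can lack an owner, and summing over the directions
  counts every rook twice. The constant is obtained before \<open>n\<close> is chosen, so the error
  has lower order.\<close>

lemma card_linked_rooks_ge:
  assumes "k \<ge> 2"
  obtains C where "\<And>n. k * n ^ (k - 1) \<le> 2 * card (linked_rooks n k) + C * n ^ (k - 2)"
proof -
  define C where "C = k * (k * ((2 * k + 1) * (2 * k + 1))) + 2 * (k * (k + 1))"
  have "k * n ^ (k - 1) \<le> 2 * card (linked_rooks n k) + k * C * n ^ (k - 2)" for n
  proof -
    let ?S = "linked_rooks n k"
    have fin: "finite (owners ?S i)" for i
      using nonattacking_finite[OF nonattacking_linked_rooks] by (simp add: owners_def)
    have "n ^ (k - 1) \<le> card (owners ?S i) + C * n ^ (k - 2)" if i: "i < k" for i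
    proof -
      let ?L = "({..<k} - {i}) \<rightarrow>\<^sub>E {..<n}"
      have "finite (bad_lines n k i)"
        by (rule finite_subset[of _ ?L]) (auto simp: bad_lines_def intro: finite_PiE)
      hence "card ?L \<le> card (line k i ` owners ?S i \<union> bad_lines n k i)"
        using good_line_owned[OF i assms] fin by (intro card_mono) auto
      also have "\<dots> \<le> card (owners ?S i) + card (bad_lines n k i)"
        by (intro order_trans[OF card_Un_le] add_right_mono card_image_le fin)
      also have "\<dots> \<le> card (owners ?S i) + C * n ^ (k - 2)"
        using card_bad_lines_le[OF i] by (simp add: C_def)
      finally show ?thesis using i by (simp only: card_lines)
    qed
    hence "(\<Sum>i<k. n ^ (k - 1)) \<le> (\<Sum>i<k. card (owners ?S i) + C * n ^ (k - 2))"
      by (intro sum_mono) auto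
    thus ?thesis
      by (simp add: sum.distrib sum_card_owners[OF nonattacking_linked_rooks])
  qed
  thus ?thesis by (rule that)
qed

section \<open>Passage to the limit\<close>

lemma max_rooks_upper: "l * max_rooks n k l \<le> k * n ^ (k - 1)"
proof -
  have "max_rooks n k l \<in> card ` {S. nonattacking n k l S}"
    unfolding max_rooks_def using finite_nonattacking nonattacking_empty by (intro Max_in) blast+
  thus ?thesis using card_nonattacking_le by auto
qed

lemma card_le_max_rooks: "nonattacking n k l S \<Longrightarrow> card S \<le> max_rooks n k l"
  unfolding max_rooks_def using finite_nonattacking by (intro Max_ge) auto

theorem theorem20:
  fixes k :: nat
  assumes "k \<ge> 2"
  shows "(\<lambda>n. real (max_rooks n k 2) / real n ^ (k - 1)) \<longlonglongrightarrow> real k / 2"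
proof -
  obtain C where C: "\<And>n. k * n ^ (k - 1) \<le> 2 * card (linked_rooks n k) + C * n ^ (k - 2)"
    using card_linked_rooks_ge[OF assms] by blast
  \<comment> \<open>The error \<open>C * n ^ (k - 2)\<close>, divided by
    \<open>2 * n ^ (k - 1)\<close>, becomes \<open>C / (2 * n)\<close>.\<close>
  have lower: "real k / 2 - real C / 2 / real n \<le> real (max_rooks n k 2) / real n ^ (k - 1)"
    if "n > 0" for n
  proof -
    have "k * n ^ (k - 1) \<le> 2 * max_rooks n k 2 + C * n ^ (k - 2)"
      using C[of n] card_le_max_rooks[OF nonattacking_linked_rooks, of n k] by linarith
    hence "real (k * n ^ (k - 1)) \<le> real (2 * max_rooks n k 2 + C * n ^ (k - 2))"
      by (rule of_nat_mono)
    hence "(real k * real n ^ (k - 1) - real C * real n ^ (k - 2)) / (2 * real n ^ (k - 1))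
        \<le> 2 * real (max_rooks n k 2) / (2 * real n ^ (k - 1))"
      by (intro divide_right_mono) auto
    moreover have "real n ^ (k - 1) = real n * real n ^ (k - 2)"
      using assms by (simp flip: power_Suc add: Suc_diff_Suc numeral_2_eq_2)
    ultimately show ?thesis using that by (simp add: diff_divide_distrib)
  qed
  have upper: "real (max_rooks n k 2) / real n ^ (k - 1) \<le> real k / 2" if "n > 0" for n
  proof -
    have "real (2 * max_rooks n k 2) \<le> real (k * n ^ (k - 1))"
      by (rule of_nat_mono[OF max_rooks_upper])
    thus ?thesis using that by (simp add: field_simps)
  qed
  have "(\<lambda>n. real k / 2 - real C / 2 / real n) \<longlonglongrightarrow> real k / 2 - 0"
    by (intro tendsto_diff tendsto_const lim_const_over_n)
  hence "(\<lambda>n. real k / 2 - real C / 2 / real n) \<longlonglongrightarrow> real k / 2" by simp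
  thus ?thesis
    by (rule tendsto_sandwich[rotated 2, OF _ tendsto_const])
      (use lower upper in \<open>auto intro!: eventually_mono[OF eventually_gt_at_top[of 0]]\<close>)
qed

end
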